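(* Let $f:\mathbb{T}\to[0,1]$ be a Borel function with $\sigma:=\int_{\mathbb{T}} f\,d\mathfrak{m}\in(0,1)$, and let $\mathfrak{X}=\mathfrak{X}(\omega)$ be the determinantal point process on $\mathbb{Z}$ induced by the kernel $K_f(n,m)=\widehat{f}(n-m)$, defined on a probability space $(\Omega,\mathcal{A},\mathbb{P})$. Then for $\mathbb{P}$-almost every $\omega$, the random subset $\mathfrak{X}=\mathfrak{X}(\omega)$ satisfies $$\mathfrak{X}+\mathfrak{X}=\mathbb{Z}.$$
   Context: $\mathbb{T}=\mathbb{R}/\mathbb{Z}$ with normalized Lebesgue measure $\mathfrak{m}$; $\widehat{f}(n)=\int_{\mathbb{T}} f(t)e^{-2\pi i n t}\,d\mathfrak{m}(t)$. The (stationary) determinantal point process $\mathfrak{X}$ induced by $K_f$ is the random subset of $\mathbb{Z}$ whose indicator random variables $\xi_n(\omega)=1$ if $n\in\mathfrak{X}(\omega)$ and $\xi_n(\omega)=0$ otherwise satisfy, for all distinct $n_1,\dots,n_k\in\mathbb{Z}$, $\mathbb{E}(\xi_{n_1}\cdots\xi_{n_k})=\det(\widehat{f}(n_i-n_j))_{1\le i,j\le k}$. Such a process exists and its law is uniquely determined by $f$. For $A,B\subset\mathbb{Z}$, $A+B:=\{a+b: a\in A,\ b\in B\}$. *)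

theory Defs
  imports "HOL-Probability.Probability" "HOL-Library.Set_Algebras"
    "Jordan_Normal_Form.Determinant"
begin

text \<open>
  The torus \<open>\<real>/\<int>\<close> is represented by the fundamental domain \<open>[0,1)\<close>; functions on it are
  1-periodic functions on \<open>\<real>\<close>.
\<close>

definition torus_measure :: "real measure" where
  "torus_measure = restrict_space lborel {0..<1}"

definition torus_borel_fun :: "(real \<Rightarrow> real) \<Rightarrow> bool" where
  "torus_borel_fun f \<longleftrightarrow> f \<in> borel_measurable borel \<and> (\<forall>t. f (t + 1) = f t)"

definition fourier_coeff :: "(real \<Rightarrow> real) \<Rightarrow> int \<Rightarrow> complex" where
  "fourier_coeff f n =
     (\<integral>t. complex_of_real (f t) * exp (- 2 * of_real pi * \<i> * of_int n * of_real t) \<partial>torus_measure)"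

definition toeplitz_kernel :: "(real \<Rightarrow> real) \<Rightarrow> int \<Rightarrow> int \<Rightarrow> complex" where
  "toeplitz_kernel f n m = fourier_coeff f (n - m)"

text \<open>
  The theory qualifiers select the determinant and the matrices of dimension given by a natural
  number, not the type-indexed ones of the analysis library. Indices run over \<open>0,\<dots>,k-1\<close>;
  the case \<open>k = 0\<close> only says \<open>1 = 1\<close> on a probability space.
\<close>

definition determinantal_process ::
    "'w measure \<Rightarrow> (int \<Rightarrow> int \<Rightarrow> complex) \<Rightarrow> ('w \<Rightarrow> int set) \<Rightarrow> bool" where
  "determinantal_process M K X \<longleftrightarrow>
     (\<forall>n. (\<lambda>\<omega>. indicator (X \<omega>) n :: real) \<in> borel_measurable M) \<and>
     (\<forall>(k::nat) (n :: nat \<Rightarrow> int). inj_on n {..<k} \<longrightarrow>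
        complex_of_real (\<integral>\<omega>. (\<Prod>i<k. indicator (X \<omega>) (n i)) \<partial>M) =
        Determinant.det (Matrix.mat k k (\<lambda>(i, j). K (n i) (n j))))"

end

theory Submission
  imports Defs
begin

text \<open>
  By Bessel's inequality the Fourier coefficients of \<open>f\<close> vanish at infinity, so the determinants
  defining the correlations tend to \<open>\<sigma> ^ k\<close> when the \<open>k\<close> points move apart: the process is mixing
  of all orders. Fix \<open>N\<close> and \<open>k\<close>. The \<open>k\<close> events that both \<open>a * j\<close> and \<open>N - a * j\<close> belong to \<open>X\<close>
  (\<open>1 \<le> j \<le> k\<close>) therefore become independent of probability \<open>\<sigma>\<^sup>2\<close> as \<open>a\<close> tends to infinity, hence
  \<open>N\<close> is not in \<open>X + X\<close> with probability at most \<open>(1 - \<sigma>\<^sup>2) ^ k\<close>.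
\<close>

section \<open>Fourier coefficients vanish at infinity\<close>

definition torus_char :: "int \<Rightarrow> real \<Rightarrow> complex" where
  "torus_char n t = exp (- 2 * of_real pi * \<i> * of_int n * of_real t)"

lemma fourier_coeff_eq: "fourier_coeff f n = (\<integral>t. complex_of_real (f t) * torus_char n t \<partial>torus_measure)"
  by (simp add: fourier_coeff_def torus_char_def)

lemma torus_char_0 [simp]: "torus_char 0 t = 1"
  by (simp add: torus_char_def)

lemma torus_char_add: "torus_char (m + n) t = torus_char m t * torus_char n t"
  by (simp add: torus_char_def exp_add [symmetric] algebra_simps)

lemma cnj_torus_char: "cnj (torus_char n t) = torus_char (- n) t"
  by (simp add: torus_char_def exp_cnj)

lemma norm_torus_char [simp]: "norm (torus_char n t) = 1"
  by (simp add: torus_char_def)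

lemma borel_measurable_torus_char [measurable]: "torus_char n \<in> borel_measurable borel"
  unfolding torus_char_def by measurable

lemma prob_space_torus: "prob_space torus_measure"
  unfolding torus_measure_def
  by (rule prob_spaceI) (simp add: emeasure_restrict_space space_restrict_space)

lemma borel_measurable_torus: "g \<in> borel_measurable borel \<Longrightarrow> g \<in> borel_measurable torus_measure"
  unfolding torus_measure_def by (rule measurable_restrict_space1) simp

lemma integrable_torus:
  fixes g :: "real \<Rightarrow> 'b :: {banach, second_countable_topology}"
  assumes "g \<in> borel_measurable borel" "\<And>t. norm (g t) \<le> B"
  shows "integrable torus_measure g"
proof -
  interpret prob_space torus_measure by (rule prob_space_torus)
  show ?thesis
    by (rule integrable_const_bound[of _ B]) (use assms borel_measurable_torus in auto)
qed

text \<open>Orthonormality of the characters. For nonzero \<open>n\<close> the antiderivative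
  \<open>exp (c * t) / c\<close> takes the same value at 0 and at 1.\<close>

lemma integral_torus_char: "(\<integral>t. torus_char n t \<partial>torus_measure) = of_bool (n = 0)"
proof (cases "n = 0")
  case True
  interpret prob_space torus_measure by (rule prob_space_torus)
  show ?thesis using True by (simp add: prob_space)
next
  case False
  define c where "c = - 2 * of_real pi * \<i> * of_int n"
  have c: "c \<noteq> 0" using False by (simp add: c_def)
  have char: "torus_char n t = exp (c * of_real t)" for t
    by (simp add: torus_char_def c_def)
  have c1: "exp c = 1"
    using exp_2pi_1_int[of "- n"] by (simp add: c_def mult_ac)
  have deriv: "((\<lambda>t. exp (c * of_real t) / c) has_vector_derivative exp (c * of_real t))
      (at t within {0..1})" for t :: real
    by (rule has_vector_derivative_real_field[where f = "\<lambda>z. exp (c * z) / c"])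
       (use c in \<open>auto intro!: derivative_eq_intros\<close>)
  have "(\<integral>t. torus_char n t \<partial>torus_measure) = (\<integral>t. indicator {0..<1} t *\<^sub>R torus_char n t \<partial>lborel)"
    unfolding torus_measure_def by (subst integral_restrict_space) auto
  \<comment> \<open>The endpoint 1 is a null set; the fundamental theorem of calculus needs the
    closed interval.\<close>
  also have "\<dots> = (\<integral>t. indicator {0..1} t *\<^sub>R torus_char n t \<partial>lborel)"
  proof (rule integral_cong_AE)
    show "AE t in lborel. indicator {0..<1} t *\<^sub>R torus_char n t = indicator {0..1} t *\<^sub>R torus_char n t"
      using AE_lborel_singleton[of "1::real"] by eventually_elim (auto simp: indicator_def)
  qed auto
  also have "\<dots> = exp (c * of_real 1) / c - exp (c * of_real 0) / c"
    unfolding char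
    by (rule integral_FTC_atLeastAtMost) (use deriv in \<open>auto intro!: continuous_intros\<close>)
  finally show ?thesis using False c1 by simp
qed

lemma cnj_fourier_coeff: "cnj (fourier_coeff f n) = fourier_coeff f (- n)"
  unfolding fourier_coeff_eq by (subst Bochner_Integration.integral_cnj [symmetric]) (simp add: cnj_torus_char)

text \<open>The squared L2 distance from \<open>f\<close> to its Fourier sum over \<open>F\<close>
  is nonnegative; expanding it by orthonormality gives the right-hand side minus the left-hand
  side.\<close>

lemma Bessel_inequality_torus:
  assumes f: "f \<in> borel_measurable borel" "\<And>t. \<bar>f t\<bar> \<le> B" and F: "finite F"
  shows "(\<Sum>n\<in>F. (norm (fourier_coeff f n))\<^sup>2) \<le> (\<integral>t. (f t)\<^sup>2 \<partial>torus_measure)"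
proof -
  let ?T = torus_measure
  define c where "c = fourier_coeff f"
  define S where "S = (\<Sum>n\<in>F. (norm (c n))\<^sup>2)"
  have S: "of_real S = (\<Sum>n\<in>F. c n * cnj (c n))"
    unfolding S_def of_real_sum complex_norm_square ..
  \<comment> \<open>The Fourier sum of \<open>f\<close> over \<open>F\<close>. As
    \<open>torus_char\<close> carries the minus sign of \<open>fourier_coeff\<close>, frequency
    \<open>n\<close> is \<open>torus_char (- n)\<close>.\<close>
  define p where "p t = (\<Sum>n\<in>F. c n * torus_char (- n) t)" for t
  have f' [measurable]: "f \<in> borel_measurable borel" by fact
  have int_f2: "integrable ?T (\<lambda>t. (f t)\<^sup>2)"
    by (rule integrable_torus[where B = "B\<^sup>2"])
       (use power_mono[OF f(2) abs_ge_zero, of _ 2] in auto)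
  have int_fe: "integrable ?T (\<lambda>t. complex_of_real (f t) * torus_char n t)" for n
    by (rule integrable_torus[where B = B]) (use f(2) in \<open>auto simp: norm_mult\<close>)
  have int_e: "integrable ?T (torus_char n)" for n
    by (rule integrable_torus[where B = 1]) auto
  have cnj_p: "cnj (p t) = (\<Sum>n\<in>F. cnj (c n) * torus_char n t)" for t
    by (simp add: p_def cnj_torus_char)
  have expand: "complex_of_real ((norm (f t - p t))\<^sup>2) =
      of_real ((f t)\<^sup>2) - (\<Sum>n\<in>F. c n * (of_real (f t) * torus_char (- n) t))
      - (\<Sum>n\<in>F. cnj (c n) * (of_real (f t) * torus_char n t))
      + (\<Sum>n\<in>F. \<Sum>m\<in>F. c n * cnj (c m) * torus_char (m - n) t)" for t
  proof -
    have "complex_of_real ((norm (f t - p t))\<^sup>2) = (f t - p t) * (f t - cnj (p t))"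
      unfolding complex_norm_square by simp
    also have "\<dots> = of_real ((f t)\<^sup>2) - f t * p t - f t * cnj (p t) + p t * cnj (p t)"
      by (simp add: algebra_simps power2_eq_square)
    also have "p t * cnj (p t) = (\<Sum>n\<in>F. \<Sum>m\<in>F. c n * cnj (c m) * torus_char (m - n) t)"
      unfolding cnj_p unfolding p_def sum_product
      by (intro sum.cong refl) (simp add: torus_char_add[of _ "- _", simplified] mult_ac)
    finally show ?thesis
      unfolding cnj_p unfolding p_def by (simp add: sum_distrib_left mult_ac)
  qed
  have "complex_of_real (\<integral>t. (norm (f t - p t))\<^sup>2 \<partial>?T)
      = (\<integral>t. complex_of_real ((norm (f t - p t))\<^sup>2) \<partial>?T)"
    by (rule integral_complex_of_real [symmetric])
  also have "\<dots> = of_real (\<integral>t. (f t)\<^sup>2 \<partial>?T) - (\<Sum>n\<in>F. c n * c (- n)) - (\<Sum>n\<in>F. cnj (c n) * c n)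
      + (\<Sum>n\<in>F. \<Sum>m\<in>F. c n * cnj (c m) * of_bool (m - n = 0))"
    unfolding expand using int_f2 int_fe int_e
    by (simp add: integral_torus_char c_def fourier_coeff_eq del: of_real_power)
  also have "(\<Sum>n\<in>F. \<Sum>m\<in>F. c n * cnj (c m) * of_bool (m - n = 0)) = of_real S"
    using F by (simp add: of_bool_def if_distrib[of "(*) _"] sum.delta S cong: if_cong)
  \<comment> \<open>Since \<open>f\<close> is real, \<open>c (- n)\<close> is the conjugate of
    \<open>c n\<close>. So both cross terms equal \<open>S\<close>, and
    \<open>- S - S + S = - S\<close> remains.\<close>
  also have "(\<Sum>n\<in>F. c n * c (- n)) = of_real S"
    unfolding S by (simp add: c_def cnj_fourier_coeff)
  also have "(\<Sum>n\<in>F. cnj (c n) * c n) = of_real S"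
    unfolding S by (simp add: mult.commute)
  finally have "complex_of_real (\<integral>t. (norm (f t - p t))\<^sup>2 \<partial>?T) = of_real ((\<integral>t. (f t)\<^sup>2 \<partial>?T) - S)"
    by simp
  then have "(\<integral>t. (norm (f t - p t))\<^sup>2 \<partial>?T) = (\<integral>t. (f t)\<^sup>2 \<partial>?T) - S"
    by (simp only: of_real_eq_iff)
  moreover have "(\<integral>t. (norm (f t - p t))\<^sup>2 \<partial>?T) \<ge> 0" by simp
  ultimately show ?thesis by (simp add: S_def c_def)
qed

text \<open>Bessel leaves room for at most \<open>I / \<epsilon>\<^sup>2\<close> coefficients of
  modulus at least \<epsilon>. The filter \<open>cofinite\<close> on the integers treats both
  directions to infinity at once.\<close>

lemma Riemann_Lebesgue_torus:
  assumes f: "f \<in> borel_measurable borel" "\<And>t. \<bar>f t\<bar> \<le> B"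
  shows "(fourier_coeff f \<longlongrightarrow> 0) cofinite"
proof (rule tendstoI)
  fix \<epsilon> :: real assume \<epsilon>: "\<epsilon> > 0"
  define I where "I = (\<integral>t. (f t)\<^sup>2 \<partial>torus_measure)"
  have "finite {n. norm (fourier_coeff f n) \<ge> \<epsilon>}"
  proof (rule finite_if_finite_subsets_card_bdd[where C = "nat \<lceil>I / \<epsilon>\<^sup>2\<rceil>", THEN conjunct1])
    fix G assume G: "G \<subseteq> {n. norm (fourier_coeff f n) \<ge> \<epsilon>}" "finite G"
    have "card G * \<epsilon>\<^sup>2 = (\<Sum>n\<in>G. \<epsilon>\<^sup>2)" by simp
    also have "\<dots> \<le> (\<Sum>n\<in>G. (norm (fourier_coeff f n))\<^sup>2)"
      using G \<epsilon> by (intro sum_mono power_mono) auto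
    also have "\<dots> \<le> I" unfolding I_def by (rule Bessel_inequality_torus[OF f G(2)])
    finally have "real (card G) \<le> I / \<epsilon>\<^sup>2" using \<epsilon> by (simp add: field_simps)
    then show "card G \<le> nat \<lceil>I / \<epsilon>\<^sup>2\<rceil>" by linarith
  qed
  then show "eventually (\<lambda>n. dist (fourier_coeff f n) 0 < \<epsilon>) cofinite"
    by (simp add: eventually_cofinite not_less)
qed

section \<open>Mixing of all orders\<close>

text \<open>By the Leibniz formula the determinant is a polynomial in the entries.\<close>

lemma tendsto_det:
  fixes A :: "'b \<Rightarrow> nat \<times> nat \<Rightarrow> 'a :: real_normed_field"
  assumes "\<And>i j. i < k \<Longrightarrow> j < k \<Longrightarrow> ((\<lambda>x. A x (i, j)) \<longlongrightarrow> L (i, j)) F"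
  shows "((\<lambda>x. Determinant.det (Matrix.mat k k (A x))) \<longlongrightarrow> Determinant.det (Matrix.mat k k L)) F"
proof -
  have perm: "p i < k" if "p permutes {0..<k}" "i < k" for p i
    using permutes_in_image[OF that(1), of i] that(2) by simp
  show ?thesis
    unfolding Determinant.det_def
    by (auto intro!: tendsto_sum tendsto_mult tendsto_prod assms simp: perm)
qed

text \<open>Preimages of finite sets under an injection are finite.\<close>

lemma filterlim_cofinite_inj: "inj d \<Longrightarrow> filterlim d cofinite sequentially"
  by (auto simp: filterlim_iff eventually_cofinite cofinite_eq_sequentially[symmetric]
      dest!: finite_vimageI[where h = d] elim!: rev_finite_subset)

text \<open>Off the diagonal the kernel matrix tends to 0 by Riemann-Lebesgue, and on it every entry
  is the zeroth coefficient, so the limit is a scalar matrix. The index set is arbitrary because it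
  will consist of pairs.\<close>

lemma determinantal_process_mixing:
  fixes f :: "real \<Rightarrow> real" and m :: "nat \<Rightarrow> 'i \<Rightarrow> int" and X :: "'w \<Rightarrow> int set"
  assumes f: "f \<in> borel_measurable borel" "\<And>t. \<bar>f t\<bar> \<le> B"
    and X: "determinantal_process M (toeplitz_kernel f) X"
    and I: "finite I"
    and m: "\<And>i j. i \<in> I \<Longrightarrow> j \<in> I \<Longrightarrow> i \<noteq> j \<Longrightarrow>
      filterlim (\<lambda>a. m a i - m a j) cofinite sequentially"
  shows "(\<lambda>a. \<integral>\<omega>. (\<Prod>i\<in>I. indicator (X \<omega>) (m a i)) \<partial>M)
    \<longlonglongrightarrow> (\<integral>t. f t \<partial>torus_measure) ^ card I"
proof -
  define k where "k = card I"
  define s where "s = (\<integral>t. f t \<partial>torus_measure)"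
  obtain h where h: "bij_betw h {..<k} I"
    using ex_bij_betw_nat_finite[OF I] by (auto simp: k_def atLeast0LessThan)
  have inj_h: "inj_on h {..<k}" and h_in: "h i \<in> I" if "i < k" for i
    using h that by (auto simp: bij_betw_def)
  define A where "A a = (\<lambda>(i, j). toeplitz_kernel f (m a (h i)) (m a (h j)))" for a
  define L where "L = (\<lambda>(i::nat, j). if i = j then complex_of_real s else 0)"
  have "(\<lambda>a. A a (i, j)) \<longlonglongrightarrow> L (i, j)" if ij: "i < k" "j < k" for i j
  proof (cases "i = j")
    case True
    then show ?thesis
      by (simp add: A_def L_def toeplitz_kernel_def fourier_coeff_eq s_def)
  next
    case False
    then have "h i \<noteq> h j" using h ij by (auto simp: bij_betw_def inj_on_def)
    from filterlim_compose[OF Riemann_Lebesgue_torus[OF f] m[OF h_in h_in this]]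
    show ?thesis using False ij by (simp add: A_def L_def toeplitz_kernel_def)
  qed
  then have "(\<lambda>a. Determinant.det (Matrix.mat k k (A a))) \<longlonglongrightarrow> Determinant.det (Matrix.mat k k L)"
    by (rule tendsto_det)
  also have "Determinant.det (Matrix.mat k k L) = prod_list (diag_mat (Matrix.mat k k L))"
    by (rule det_upper_triangular[where n = k]) (auto simp: L_def)
  also have "\<dots> = (\<Prod>i<k. complex_of_real s)"
    by (simp add: prod_list_diag_prod L_def atLeast0LessThan)
  finally have lim: "(\<lambda>a. Determinant.det (Matrix.mat k k (A a))) \<longlonglongrightarrow> of_real (s ^ k)" by simp
  \<comment> \<open>The determinant formula holds for distinct points only. They are distinct for
    large \<open>a\<close>, since the differences eventually avoid the finite set {0}.\<close>
  have "eventually (\<lambda>a. m a i - m a j \<noteq> 0) sequentially" if "i \<in> I" "j \<in> I" "i \<noteq> j" for i j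
    using filterlim_iff[THEN iffD1, OF m[OF that], rule_format, of "\<lambda>n. n \<noteq> 0"]
    by (simp add: eventually_cofinite)
  then have "eventually (\<lambda>a. \<forall>i\<in>I. \<forall>j\<in>I. i \<noteq> j \<longrightarrow> m a i - m a j \<noteq> 0) sequentially"
    using I by (auto simp: eventually_ball_finite_distrib)
  then have "eventually (\<lambda>a. Determinant.det (Matrix.mat k k (A a)) =
      complex_of_real (\<integral>\<omega>. (\<Prod>i\<in>I. indicator (X \<omega>) (m a i)) \<partial>M)) sequentially"
  proof eventually_elim
    case (elim a)
    then have "inj_on (m a) I" by (auto simp: inj_on_def)
    then have "inj_on (\<lambda>i. m a (h i)) {..<k}"
      using comp_inj_on[of h "{..<k}" "m a"] h by (simp add: bij_betw_def o_def)
    then have "complex_of_real (\<integral>\<omega>. (\<Prod>i<k. indicator (X \<omega>) (m a (h i))) \<partial>M) =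
        Determinant.det (Matrix.mat k k (A a))"
      using X unfolding determinantal_process_def A_def by blast
    moreover have "(\<Prod>i<k. indicator (X \<omega>) (m a (h i))) = (\<Prod>i\<in>I. indicator (X \<omega>) (m a i) :: real)" for \<omega>
      by (rule prod.reindex_bij_betw[OF h])
    ultimately show ?case by simp
  qed
  from Lim_transform_eventually[OF lim this] show ?thesis
    unfolding tendsto_of_real_iff by (simp add: s_def k_def)
qed

section \<open>Representing an integer\<close>

lemma AE_mem_sumset:
  fixes f :: "real \<Rightarrow> real" and X :: "'w \<Rightarrow> int set"
  assumes f: "f \<in> borel_measurable borel" "\<And>t. f t \<in> {0..1}"
    and s: "(\<integral>t. f t \<partial>torus_measure) \<in> {0<..<1}"
    and M: "prob_space M"
    and X: "determinantal_process M (toeplitz_kernel f) X"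
  shows "AE \<omega> in M. N \<in> X \<omega> + X \<omega>"
proof -
  interpret prob_space M by fact
  define \<sigma> where "\<sigma> = (\<integral>t. f t \<partial>torus_measure)"
  have \<sigma>: "0 < \<sigma>" "\<sigma> < 1" using s by (auto simp: \<sigma>_def)
  have f1: "\<bar>f t\<bar> \<le> 1" for t using f(2)[of t] by auto
  have ind_meas: "(\<lambda>\<omega>. indicator (X \<omega>) n :: real) \<in> borel_measurable M" for n
    using X by (simp add: determinantal_process_def)
  have [measurable]: "Measurable.pred M (\<lambda>\<omega>. n \<in> X \<omega>)" for n
  proof -
    have "{\<omega> \<in> space M. (indicator (X \<omega>) n :: real) = 1} \<in> sets M"
      using ind_meas[of n] by measurable
    then show ?thesis by (simp add: pred_def indicator_eq_1_iff)
  qed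
  \<comment> \<open>The event that \<open>N\<close> is not in \<open>X + X\<close>; it is measurable
    as a countable intersection.\<close>
  define bad where "bad = {\<omega> \<in> space M. \<forall>n. \<not> (n \<in> X \<omega> \<and> N - n \<in> X \<omega>)}"
  have bad_sets [measurable]: "bad \<in> sets M" unfolding bad_def by measurable
  \<comment> \<open>Indicator of the event that the pair with sum \<open>N\<close> at step
    \<open>a * Suc j\<close> lies in \<open>X\<close>. The factor \<open>Suc j\<close> is nonzero,
    so that both points move with \<open>a\<close>.\<close>
  define \<xi> :: "nat \<Rightarrow> nat \<Rightarrow> 'w \<Rightarrow> real" where
    "\<xi> a j \<omega> = indicator (X \<omega>) (int (a * Suc j)) * indicator (X \<omega>) (N - int (a * Suc j))" for a j \<omega>
  have \<xi>_meas: "\<xi> a j \<in> borel_measurable M" for a j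
    unfolding \<xi>_def using ind_meas by measurable
  have \<xi>_range: "\<xi> a j \<omega> \<in> {0..1}" for a j \<omega>
    by (auto simp: \<xi>_def indicator_def)
  have int_prod: "integrable M (\<lambda>\<omega>. \<Prod>j\<in>S. \<xi> a j \<omega>)" for S a
    by (rule integrable_const_bound[where B = 1])
       (use \<xi>_meas \<xi>_range in \<open>auto simp: abs_prod intro!: prod_le_1 borel_measurable_prod\<close>)
  have int_prod': "integrable M (\<lambda>\<omega>. \<Prod>j<k. 1 - \<xi> a j \<omega>)" for k a
    using int_prod by (simp add: prod_diff_conv_sum)
  have lim: "(\<lambda>a. \<integral>\<omega>. (\<Prod>j\<in>S. \<xi> a j \<omega>) \<partial>M) \<longlonglongrightarrow> (\<sigma>\<^sup>2) ^ card S" if S: "finite S" for S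
  proof -
    \<comment> \<open>The boolean chooses between a point and its reflection
      \<open>N - n\<close>.\<close>
    define m where "m a = (\<lambda>(j, b). if b then int (a * Suc j) else N - int (a * Suc j))" for a
    have "filterlim (\<lambda>a. m a u - m a v) cofinite sequentially" if "u \<noteq> v" for u v
    proof (rule filterlim_cofinite_inj, rule injI)
      fix a a' assume eq: "m a u - m a v = m a' u - m a' v"
      obtain i b j c where uv: "u = (i, b)" "v = (j, c)" by (metis surj_pair)
      \<comment> \<open>The slope of \<open>m a u - m a v\<close>, which is affine in
        \<open>a\<close>. With equal signs it is nonzero because \<open>i\<close> and
        \<open>j\<close> differ, with opposite signs because \<open>Suc i + Suc j\<close> is
        positive.\<close>
      define d where "d = (if b then 1 else - 1) * int (Suc i) - (if c then 1 else - 1) * int (Suc j)"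
      have "d \<noteq> 0" using that by (auto simp: uv d_def split: if_splits)
      moreover have "int a * d = int a' * d"
        using eq by (auto simp: uv d_def m_def algebra_simps split: if_splits)
      ultimately show "a = a'" by simp
    qed
    then have "(\<lambda>a. \<integral>\<omega>. (\<Prod>u\<in>S \<times> UNIV. indicator (X \<omega>) (m a u)) \<partial>M) \<longlonglongrightarrow>
        \<sigma> ^ card (S \<times> (UNIV :: bool set))"
      unfolding \<sigma>_def
      by (intro determinantal_process_mixing[OF f(1) f1 X]) (use S in auto)
    moreover have "(\<Prod>u\<in>S \<times> UNIV. indicator (X \<omega>) (m a u)) = (\<Prod>j\<in>S. \<xi> a j \<omega>)" for a \<omega>
    proof -
      have "(\<Prod>u\<in>S \<times> UNIV. indicator (X \<omega>) (m a u)) = (\<Prod>j\<in>S. \<Prod>b\<in>UNIV. indicator (X \<omega>) (m a (j, b)) :: real)"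
        by (simp add: prod.cartesian_product split_def)
      also have "\<dots> = (\<Prod>j\<in>S. \<xi> a j \<omega>)"
        by (intro prod.cong refl) (simp add: UNIV_bool m_def \<xi>_def mult.commute)
      finally show ?thesis .
    qed
    moreover have "\<sigma> ^ card (S \<times> (UNIV :: bool set)) = (\<sigma>\<^sup>2) ^ card S"
      by (simp add: card_cartesian_product power_mult[symmetric] mult.commute)
    ultimately show ?thesis by simp
  qed
  have bound: "prob bad \<le> (1 - \<sigma>\<^sup>2) ^ k" for k
  proof -
    \<comment> \<open>Inclusion-exclusion: the product expands into a signed sum over subsets,
      \<open>lim\<close> applies to each term, and the limits recombine by the same
      identity.\<close>
    have "(\<lambda>a. \<integral>\<omega>. (\<Prod>j<k. 1 - \<xi> a j \<omega>) \<partial>M) \<longlonglongrightarrow> (\<Sum>S\<in>Pow {..<k}. (-1) ^ card S * (\<sigma>\<^sup>2) ^ card S)"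
      using int_prod
      by (auto simp: prod_diff_conv_sum intro!: tendsto_sum tendsto_mult lim dest: finite_subset)
    also have "(\<Sum>S\<in>Pow {..<k}. (-1) ^ card S * (\<sigma>\<^sup>2) ^ card S) = (1 - \<sigma>\<^sup>2) ^ k"
      using prod_diff_conv_sum[of "{..<k}" "\<lambda>_. 1" "\<lambda>_. \<sigma>\<^sup>2"] by simp
    finally show ?thesis
    \<comment> \<open>The bound holds for every \<open>a\<close>: on \<open>bad\<close> all \<xi>
      vanish and the product is 1, elsewhere it is nonnegative.\<close>
    proof (rule LIMSEQ_le_const, intro exI allI impI)
      fix a
      have "prob bad = (\<integral>\<omega>. indicator bad \<omega> \<partial>M)" using bad_sets by simp
      also have "\<dots> \<le> (\<integral>\<omega>. (\<Prod>j<k. 1 - \<xi> a j \<omega>) \<partial>M)"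
      proof (rule integral_mono)
        show "indicator bad \<omega> \<le> (\<Prod>j<k. 1 - \<xi> a j \<omega>)" for \<omega>
        proof (cases "\<omega> \<in> bad")
          case True
          then have "\<xi> a j \<omega> = 0" for j by (auto simp: bad_def \<xi>_def indicator_def)
          then show ?thesis by (simp add: indicator_def)
        next
          case False
          then show ?thesis using \<xi>_range by (auto intro!: prod_nonneg)
        qed
      qed (use bad_sets int_prod' in \<open>auto intro!: integrable_real_indicator simp: less_top[symmetric]\<close>)
      finally show "prob bad \<le> (\<integral>\<omega>. (\<Prod>j<k. 1 - \<xi> a j \<omega>) \<partial>M)" .
    qed
  qed
  have "(\<lambda>k. (1 - \<sigma>\<^sup>2) ^ k) \<longlonglongrightarrow> 0"
    using \<sigma> by (intro LIMSEQ_realpow_zero) (auto simp: power_le_one)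
  then have "prob bad \<le> 0"
    by (rule LIMSEQ_le_const) (use bound in auto)
  then have "bad \<in> null_sets M"
    using bad_sets by (simp add: null_sets_def emeasure_eq_measure measure_le_0_iff)
  then have "AE \<omega> in M. \<omega> \<notin> bad" by (rule AE_not_in)
  then show ?thesis
  proof (rule AE_mp, intro AE_I2 impI)
    fix \<omega> assume "\<omega> \<in> space M" "\<omega> \<notin> bad"
    then obtain n where "n \<in> X \<omega>" "N - n \<in> X \<omega>" by (auto simp: bad_def)
    then have "n + (N - n) \<in> X \<omega> + X \<omega>" by (rule set_plus_intro)
    then show "N \<in> X \<omega> + X \<omega>" by simp
  qed
qed

theorem theorem5p1:
  fixes f :: "real \<Rightarrow> real" and \<sigma> :: real and M :: "'w measure" and X :: "'w \<Rightarrow> int set"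
  assumes "torus_borel_fun f"
    and "\<And>t. f t \<in> {0..1}"
    and "\<sigma> = (\<integral>t. f t \<partial>torus_measure)"
    and "\<sigma> \<in> {0<..<1}"
    and "prob_space M"
    and "determinantal_process M (toeplitz_kernel f) X"
  shows "AE \<omega> in M. X \<omega> + X \<omega> = (UNIV :: int set)"
proof -
  have "AE \<omega> in M. N \<in> X \<omega> + X \<omega>" for N
    using assms by (intro AE_mem_sumset[of f]) (auto simp: torus_borel_fun_def)
  \<comment> \<open>The exceptional null sets can be united because there are only countably many
    integers.\<close>
  then have "AE \<omega> in M. \<forall>N. N \<in> X \<omega> + X \<omega>"
    by (simp add: AE_all_countable)
  then show ?thesis by eventually_elim auto
qed

end
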